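(* Let $X$ be a non-discrete Tychonoff $P$-space. Then: (i) $X$ is a hereditary sequentially Ascoli space; (ii) $X$ is not $2$-Ascoli; (iii) if additionally $X$ is a one-point Lindelöfication of an uncountable discrete set, then $X$ is a hereditary Baire space.
   Context: A topological space is a $P$-space if each of its $G_\delta$-subsets is open. For Tychonoff spaces $X$ and $Y$, $C_k(X,Y)$ is the space of continuous functions $X\to Y$ with the compact-open topology. $X$ is sequentially Ascoli if every convergent sequence $S$ in $C_k(X,\mathbb{R})$ is equicontinuous (for every $x\in X$ and $\varepsilon>0$ there is a neighborhood $O$ of $x$ with $|f(t)-f(x)|<\varepsilon$ for all $t\in O$, $f\in S$). $X$ is $2$-Ascoli if every compact subset $K$ of $C_k(X,\mathbf{2})$ is evenly continuous, i.e. the evaluation map $K\times X\to\mathbf{2}$, $(f,x)\mapsto f(x)$, is continuous, where $\mathbf{2}=\{0,1\}$ is discrete. "Hereditary $\mathcal{P}$" means that every subspace has property $\mathcal{P}$. The one-point Lindelöfication of an uncountable discrete set $D$ is the space $D\cup\{x_\infty\}$, $x_\infty\notin D$, in which points of $D$ are isolated and the neighborhoods of $x_\infty$ are the sets containing $x_\infty$ with countable complement. A space is Baire if every countable intersection of dense open subsets is dense. *)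

theory Defs
  imports "HOL-Analysis.Analysis"
begin

definition Tychonoff_space :: "'a topology \<Rightarrow> bool" where
  "Tychonoff_space X \<longleftrightarrow> completely_regular_space X \<and> Hausdorff_space X"

definition P_space :: "'a topology \<Rightarrow> bool" where
  "P_space X \<longleftrightarrow> (\<forall>S. gdelta_in X S \<longrightarrow> openin X S)"

text \<open>Continuous maps are represented by functions that are \<open>undefined\<close> off the carrier, so
  that distinct points of the function space are distinct maps.\<close>

definition cont_maps :: "'a topology \<Rightarrow> 'b topology \<Rightarrow> ('a \<Rightarrow> 'b) set" where
  "cont_maps X Y = {f \<in> extensional (topspace X). continuous_map X Y f}"

text \<open>The subbase below contains the whole space (take the empty compact set), so the
  carrier of \<open>Ck X Y\<close> is \<open>cont_maps X Y\<close>.\<close>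

definition Ck :: "'a topology \<Rightarrow> 'b topology \<Rightarrow> ('a \<Rightarrow> 'b) topology" where
  "Ck X Y = topology_generated_by
     {{f \<in> cont_maps X Y. f ` K \<subseteq> U} |K U. compactin X K \<and> openin Y U}"

lemma topspace_Ck: "topspace (Ck X Y) = cont_maps X Y"
proof -
  have "cont_maps X Y \<in> {{f \<in> cont_maps X Y. f ` K \<subseteq> U} |K U. compactin X K \<and> openin Y U}"
    by (rule CollectI, rule exI[of _ "{}"], rule exI[of _ "{}"]) auto
  then show ?thesis
    unfolding Ck_def topology_generated_by_topspace by blast
qed

definition equicontinuous :: "'a topology \<Rightarrow> ('a \<Rightarrow> real) set \<Rightarrow> bool" where
  "equicontinuous X F \<longleftrightarrow>
     (\<forall>x \<in> topspace X. \<forall>\<epsilon>>0. \<exists>U. openin X U \<and> x \<in> U \<and>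
        (\<forall>t \<in> U. \<forall>f \<in> F. \<bar>f t - f x\<bar> < \<epsilon>))"

text \<open>\<open>limitin\<close> only constrains a tail of the sequence, so membership of all terms in the
  function space is required separately.\<close>

definition sequentially_Ascoli :: "'a topology \<Rightarrow> bool" where
  "sequentially_Ascoli X \<longleftrightarrow>
     (\<forall>s :: nat \<Rightarrow> 'a \<Rightarrow> real.
        range s \<subseteq> topspace (Ck X euclideanreal) \<and>
        (\<exists>l. limitin (Ck X euclideanreal) s l sequentially)
        \<longrightarrow> equicontinuous X (range s))"

definition two :: "nat topology" where
  "two = discrete_topology {0, 1}"

definition evenly_continuous :: "'a topology \<Rightarrow> 'b topology \<Rightarrow> ('a \<Rightarrow> 'b) set \<Rightarrow> bool" where
  "evenly_continuous X Y K \<longleftrightarrow>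
     continuous_map (prod_topology (subtopology (Ck X Y) K) X) Y (\<lambda>(f, x). f x)"

definition two_Ascoli :: "'a topology \<Rightarrow> bool" where
  "two_Ascoli X \<longleftrightarrow> (\<forall>K. compactin (Ck X two) K \<longrightarrow> evenly_continuous X two K)"

text \<open>Neighborhoods are not assumed open.\<close>

definition neighborhood_in :: "'a topology \<Rightarrow> 'a \<Rightarrow> 'a set \<Rightarrow> bool" where
  "neighborhood_in X x N \<longleftrightarrow> N \<subseteq> topspace X \<and> (\<exists>U. openin X U \<and> x \<in> U \<and> U \<subseteq> N)"

definition one_point_Lindelofication :: "'a topology \<Rightarrow> 'a set \<Rightarrow> 'a \<Rightarrow> bool" where
  "one_point_Lindelofication X D p \<longleftrightarrow>
     uncountable D \<and> p \<notin> D \<and> topspace X = insert p D \<and>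
     (\<forall>d \<in> D. openin X {d}) \<and>
     (\<forall>N. neighborhood_in X p N \<longleftrightarrow>
        N \<subseteq> topspace X \<and> p \<in> N \<and> countable (topspace X - N))"

definition Baire_space :: "'a topology \<Rightarrow> bool" where
  "Baire_space X \<longleftrightarrow>
     (\<forall>\<U>. countable \<U> \<and> (\<forall>U \<in> \<U>. openin X U \<and> X closure_of U = topspace X)
        \<longrightarrow> X closure_of (topspace X \<inter> \<Inter>\<U>) = topspace X)"

end

(* In a P-space countably many neighborhoods of a point have a common refinement, so every countable
   family of continuous real functions is equicontinuous, and compact sets are finite. For (ii), a
   maximal disjoint family of clopen sets missing a non-isolated point x accumulates at x; the
   characteristic functions of its members together with 0 form a compact set (the one-point
   compactification of a discrete set, since each finite set meets only finitely many members) on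
   which evaluation is discontinuous at (0, x). For (iii), all points but one of each subspace
   are isolated, so a dense open set misses at most that one point. *)
theory Submission
  imports Defs
begin

section \<open>P-spaces: countable intersections, finite compact sets, clopen neighborhoods\<close>

lemma P_space_openin_countable_INT:
  assumes "P_space X" "countable I" "\<And>i. i \<in> I \<Longrightarrow> openin X (U i)"
  shows "openin X (topspace X \<inter> (\<Inter>i\<in>I. U i))"
proof (cases "I = {}")
  \<comment> \<open>Over an empty index set the bare intersection is \<open>UNIV\<close>; the factor
    \<open>topspace X\<close> keeps the claim true.\<close>
  case True
  then show ?thesis by simp
next
  case False
  then have "gdelta_in X (\<Inter>(U ` I))"
    using assms by (intro gdelta_in_Inter) (auto intro: open_imp_gdelta_in)
  then show ?thesis
    using assms(1) by (auto simp: P_space_def)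
qed

text \<open>A G-delta of a subspace is the trace of a G-delta of \<open>X\<close>. This is what
  makes (i) hereditary.\<close>

lemma P_space_subtopology:
  assumes "P_space X"
  shows "P_space (subtopology X S)"
  using assms by (auto simp: P_space_def gdelta_in_subtopology openin_subtopology)

lemma P_space_equicontinuous:
  assumes "P_space X" "countable F" "\<And>f. f \<in> F \<Longrightarrow> continuous_map X euclideanreal f"
  shows "equicontinuous X F"
  unfolding equicontinuous_def
proof (intro ballI allI impI)
  fix x and \<epsilon> :: real
  assume x: "x \<in> topspace X" and "\<epsilon> > 0"
  define V where "V f = {t \<in> topspace X. f t \<in> {f x - \<epsilon> <..< f x + \<epsilon>}}" for f
  have "openin X (V f)" if "f \<in> F" for f
    unfolding V_def using assms(3)[OF that]
    by (rule openin_continuous_map_preimage) (simp flip: open_openin)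
  then have "openin X (topspace X \<inter> (\<Inter>f\<in>F. V f))"
    by (rule P_space_openin_countable_INT[OF assms(1,2)])
  moreover have "x \<in> topspace X \<inter> (\<Inter>f\<in>F. V f)"
    using x \<open>\<epsilon> > 0\<close> by (simp add: V_def)
  moreover have "\<bar>f t - f x\<bar> < \<epsilon>" if "t \<in> topspace X \<inter> (\<Inter>f\<in>F. V f)" "f \<in> F" for t f
    using that by (auto simp: V_def)
  ultimately show "\<exists>U. openin X U \<and> x \<in> U \<and> (\<forall>t\<in>U. \<forall>f\<in>F. \<bar>f t - f x\<bar> < \<epsilon>)"
    by blast
qed

lemma P_space_sequentially_Ascoli:
  assumes "P_space X"
  shows "sequentially_Ascoli X"
  unfolding sequentially_Ascoli_def topspace_Ck
  using assms by (auto simp: cont_maps_def intro!: P_space_equicontinuous)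

text \<open>A countably infinite subset \<open>A\<close> of \<open>C\<close> would accumulate at
  some \<open>x\<close>. Removing the countably many points of \<open>A\<close> other than
  \<open>x\<close> still leaves an open neighborhood of \<open>x\<close>, a contradiction.\<close>

lemma P_space_compactin_imp_finite:
  assumes "P_space X" "t1_space X" "compactin X C"
  shows "finite C"
proof (rule ccontr)
  assume "infinite C"
  then obtain A where A: "countable A" "infinite A" "A \<subseteq> C"
    using infinite_countable_subset' by blast
  then obtain x where x: "x \<in> X derived_set_of A"
    using compactin_imp_Bolzano_Weierstrass[OF assms(3)] by blast
  define W where "W = topspace X \<inter> (\<Inter>a\<in>A - {x}. topspace X - {a})"
  have "openin X W"
    unfolding W_def
  proof (rule P_space_openin_countable_INT[OF assms(1)])
    show "openin X (topspace X - {a})" if "a \<in> A - {x}" for a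
      using that A(3) compactin_subset_topspace[OF assms(3)] assms(2)
      by (auto simp: t1_space_closedin_singleton)
  qed (use A in auto)
  moreover have "x \<in> W"
    using x by (auto simp: W_def in_derived_set_of)
  ultimately obtain y where y: "y \<noteq> x" "y \<in> A" "y \<in> W"
    using x unfolding in_derived_set_of by blast
  then have "y \<in> topspace X - {y}"
    unfolding W_def by blast
  then show False
    by simp
qed

text \<open>Take the zero set of a function that is 0 at \<open>x\<close> and 1 off
  \<open>W\<close>. It is closed by continuity, and open as the intersection of the preimages of the
  intervals (-1/(n+1), 1/(n+1)).\<close>

lemma P_space_clopen_nbhd:
  assumes "completely_regular_space X" "P_space X" "openin X W" "x \<in> W"
  obtains U where "openin X U" "closedin X U" "x \<in> U" "U \<subseteq> W"
proof -
  have "closedin X (topspace X - W)" "x \<in> topspace X - (topspace X - W)"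
    using assms openin_subset by fastforce+
  then obtain f :: "'a \<Rightarrow> real" where f: "continuous_map X (top_of_set {0..1}) f" "f x = 0"
      "f ` (topspace X - W) \<subseteq> {1}"
    using assms(1) unfolding completely_regular_space_def by metis
  have fc: "continuous_map X euclideanreal f"
    using f(1) continuous_map_in_subtopology by blast
  define U where "U = {t \<in> topspace X. f t \<in> {0}}"
  have "closedin X U"
    unfolding U_def by (rule closedin_continuous_map_preimage[OF fc]) simp
  have "U = topspace X \<inter> (\<Inter>n. {t \<in> topspace X. f t \<in> {- inverse (Suc n) <..< inverse (Suc n)}})"
    (is "_ = topspace X \<inter> (\<Inter>n. ?V n)")
  proof
    have "f t = 0" if "\<And>n. \<bar>f t\<bar> < inverse (Suc n)" for t
      using reals_Archimedean[of "\<bar>f t\<bar>"] that by (force simp: not_less dest: less_asym)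
    then show "topspace X \<inter> (\<Inter>n. ?V n) \<subseteq> U"
      by (auto simp: U_def abs_less_iff minus_less_iff)
  qed (auto simp: U_def)
  moreover have "openin X (topspace X \<inter> (\<Inter>n. ?V n))"
    by (intro P_space_openin_countable_INT[OF assms(2)] openin_continuous_map_preimage[OF fc])
      (auto simp flip: open_openin)
  ultimately have "openin X U"
    by simp
  moreover have "x \<in> U" "U \<subseteq> W"
    using f assms openin_subset[OF assms(3)] by (auto simp: U_def)
  ultimately show thesis
    using \<open>closedin X U\<close> that by blast
qed

section \<open>Compact sets of functions formed by a family and its limit\<close>

lemma finite_not_in_openin_Ck:
  assumes "openin (Ck X Y) W" "z \<in> W"
    and basic: "\<And>K V. \<lbrakk>compactin X K; openin Y V; z ` K \<subseteq> V\<rbrakk> \<Longrightarrow> finite {a \<in> A. \<not> g a ` K \<subseteq> V}"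
    and g: "\<And>a. a \<in> A \<Longrightarrow> g a \<in> cont_maps X Y"
  shows "finite {a \<in> A. g a \<notin> W}"
  \<comment> \<open>It suffices to test the subbase: a binary intersection unites two finite
    exceptional sets, and in a union one member containing \<open>z\<close> already excludes only
    finitely many indices.\<close>
  using openin_topology_generated_by[OF assms(1)[unfolded Ck_def]] assms(2)
proof (induction W rule: generate_topology_on.induct)
  case Empty
  then show ?case by simp
next
  case (Int V V')
  then have "finite ({a \<in> A. g a \<notin> V} \<union> {a \<in> A. g a \<notin> V'})"
    by simp
  then show ?case
    by (rule rev_finite_subset) auto
next
  case (UN \<V>)
  then obtain V where "V \<in> \<V>" "finite {a \<in> A. g a \<notin> V}"
    by blast
  then show ?case
    by (elim rev_finite_subset) auto
next
  case (Basis s)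
  then obtain K V where KV: "compactin X K" "openin Y V"
    and s: "s = {f \<in> cont_maps X Y. f ` K \<subseteq> V}"
    by blast
  then have "finite {a \<in> A. \<not> g a ` K \<subseteq> V}"
    using Basis by (intro basic) auto
  then show ?case
    by (rule rev_finite_subset) (use g s in auto)
qed

text \<open>A cover member containing \<open>z\<close> takes in all but finitely many
  \<open>g a\<close>; each remaining one costs one further member.\<close>

lemma compactin_insert_cofinite:
  assumes "z \<in> topspace T" "g ` A \<subseteq> topspace T"
    and cofin: "\<And>W. \<lbrakk>openin T W; z \<in> W\<rbrakk> \<Longrightarrow> finite {a \<in> A. g a \<notin> W}"
  shows "compactin T (insert z (g ` A))"
  unfolding compactin_def
proof (intro conjI allI impI)
  show "insert z (g ` A) \<subseteq> topspace T"
    using assms by blast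
  fix \<U> assume \<U>: "(\<forall>U\<in>\<U>. openin T U) \<and> insert z (g ` A) \<subseteq> \<Union>\<U>"
  then obtain W where W: "W \<in> \<U>" "z \<in> W" by blast
  have fin: "finite {a \<in> A. g a \<notin> W}"
    using cofin W \<U> by blast
  have "\<forall>a \<in> A. \<exists>U \<in> \<U>. g a \<in> U"
    using \<U> by blast
  then obtain h where h: "\<And>a. a \<in> A \<Longrightarrow> h a \<in> \<U> \<and> g a \<in> h a"
    by metis
  show "\<exists>\<F>. finite \<F> \<and> \<F> \<subseteq> \<U> \<and> insert z (g ` A) \<subseteq> \<Union>\<F>"
    by (rule exI[of _ "insert W (h ` {a \<in> A. g a \<notin> W})"]) (use fin W h in auto)
qed

section \<open>Failure of the 2-Ascoli property\<close>

lemma maximal_disjoint_subfamily: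
  obtains \<M> where "\<M> \<subseteq> \<C>" "disjoint \<M>"
    "\<And>U. \<lbrakk>U \<in> \<C>; \<And>V. V \<in> \<M> \<Longrightarrow> disjnt U V\<rbrakk> \<Longrightarrow> U \<in> \<M>"
proof -
  \<comment> \<open>Zorn's lemma for inclusion. The union of a chain is again disjoint, since any
    two of its sets already lie in a single member of the chain.\<close>
  have "\<exists>\<M>\<in>{\<M>. \<M> \<subseteq> \<C> \<and> disjoint \<M>}. \<forall>\<N>\<in>{\<M>. \<M> \<subseteq> \<C> \<and> disjoint \<M>}. \<M> \<subseteq> \<N> \<longrightarrow> \<N> = \<M>"
  proof (rule subset_Zorn')
    fix \<K> assume "subset.chain {\<M>. \<M> \<subseteq> \<C> \<and> disjoint \<M>} \<K>"
    then have sub: "\<K> \<subseteq> {\<M>. \<M> \<subseteq> \<C> \<and> disjoint \<M>}"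
      and lin: "\<And>\<M> \<N>. \<lbrakk>\<M> \<in> \<K>; \<N> \<in> \<K>\<rbrakk> \<Longrightarrow> \<M> \<subseteq> \<N> \<or> \<N> \<subseteq> \<M>"
      by (auto simp: subset_chain_def)
    have "disjoint (\<Union>\<K>)"
    proof (rule pairwiseI)
      fix U V assume UV: "U \<in> \<Union>\<K>" "V \<in> \<Union>\<K>" "U \<noteq> V"
      then obtain \<M> where "\<M> \<in> \<K>" "U \<in> \<M>" "V \<in> \<M>"
        using lin by (elim UnionE) (metis subsetD)
      moreover have "disjoint \<M>"
        using subsetD[OF sub \<open>\<M> \<in> \<K>\<close>] by simp
      ultimately show "disjnt U V"
        using UV(3) by (simp add: pairwiseD)
    qed
    moreover have "\<Union>\<K> \<subseteq> \<C>"
      using sub by blast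
    ultimately show "\<Union>\<K> \<in> {\<M>. \<M> \<subseteq> \<C> \<and> disjoint \<M>}"
      by simp
  qed
  then obtain \<M> where "\<M> \<in> {\<M>. \<M> \<subseteq> \<C> \<and> disjoint \<M>}"
    and all: "\<forall>\<N>\<in>{\<M>. \<M> \<subseteq> \<C> \<and> disjoint \<M>}. \<M> \<subseteq> \<N> \<longrightarrow> \<N> = \<M>" ..
  then have \<M>: "\<M> \<subseteq> \<C>" "disjoint \<M>"
    by simp_all
  have max: "\<N> = \<M>" if "\<N> \<subseteq> \<C>" "disjoint \<N>" "\<M> \<subseteq> \<N>" for \<N>
    using all that by simp
  have "U \<in> \<M>" if "U \<in> \<C>" "\<And>V. V \<in> \<M> \<Longrightarrow> disjnt U V" for U
  proof -
    have "disjoint (insert U \<M>)"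
      using \<M>(2) that(2) by (auto simp: pairwise_insert disjnt_sym)
    then have "insert U \<M> = \<M>"
      using that(1) \<M>(1) by (intro max) auto
    then show ?thesis
      by auto
  qed
  with \<M> show thesis
    by (rule that)
qed

lemma nonisolated_point_exists:
  assumes "X \<noteq> discrete_topology (topspace X)"
  obtains x where "x \<in> topspace X" "\<not> openin X {x}"
  using assms discrete_topology_unique[of "topspace X" X] by auto

lemma P_space_not_two_Ascoli:
  assumes "Tychonoff_space X" "P_space X" "X \<noteq> discrete_topology (topspace X)"
  shows "\<not> two_Ascoli X"
proof
  assume Ascoli: "two_Ascoli X"
  have cr: "completely_regular_space X" and t1: "t1_space X"
    using assms(1) by (auto simp: Tychonoff_space_def Hausdorff_imp_t1_space)
  obtain x where x: "x \<in> topspace X" "\<not> openin X {x}"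
    using nonisolated_point_exists[OF assms(3)] .
  define \<C> where "\<C> = {U. openin X U \<and> closedin X U \<and> x \<notin> U}"
  obtain \<M> where \<M>: "\<M> \<subseteq> \<C>" "disjoint \<M>"
    and max: "\<And>U. \<lbrakk>U \<in> \<C>; \<And>V. V \<in> \<M> \<Longrightarrow> disjnt U V\<rbrakk> \<Longrightarrow> U \<in> \<M>"
    using maximal_disjoint_subfamily[of \<C>] by metis
  \<comment> \<open>The members of \<open>\<M>\<close> accumulate at \<open>x\<close>. A
    non-isolated \<open>x\<close> leaves another point \<open>y\<close> in \<open>G\<close>, and
    \<open>y\<close> has a clopen neighborhood \<open>U\<close> inside \<open>G - {x}\<close>. If no
    member met \<open>G\<close>, then \<open>U\<close> would be disjoint from all of them, hence a
    member by maximality, yet it meets \<open>G\<close> in \<open>y\<close>.\<close>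
  have meets: "\<exists>U\<in>\<M>. \<not> disjnt G U" if G: "openin X G" "x \<in> G" for G
  proof -
    have "G \<noteq> {x}"
      using G x by blast
    then obtain y where y: "y \<in> G" "y \<noteq> x"
      using G by blast
    have "openin X (G - {x})"
      using G t1 x by (intro openin_diff) (auto simp: t1_space_closedin_singleton)
    then obtain U where U: "openin X U" "closedin X U" "y \<in> U" "U \<subseteq> G - {x}"
      using P_space_clopen_nbhd[OF cr assms(2)] y by blast
    then have "U \<in> \<C>"
      by (auto simp: \<C>_def)
    show ?thesis
    proof (rule ccontr)
      assume none: "\<not> ?thesis"
      then have "U \<in> \<M>"
        using U by (intro max[OF \<open>U \<in> \<C>\<close>]) (auto simp: disjnt_def)
      then show False
        using none U by (auto simp: disjnt_def)
    qed
  qed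
  \<comment> \<open>The restricted lambda gives the value \<open>undefined\<close> off the carrier,
    as \<open>cont_maps\<close> demands; \<open>ch {}\<close> is the zero map.\<close>
  define ch :: "'a set \<Rightarrow> 'a \<Rightarrow> nat"
    where "ch U = (\<lambda>t\<in>topspace X. if t \<in> U then 1 else 0)" for U
  have ch: "ch U \<in> cont_maps X two" if U: "openin X U" "closedin X U" for U
  proof -
    have "openin X {t \<in> topspace X. ch U t \<in> V}" for V
    proof -
      have "{t \<in> topspace X. ch U t \<in> V}
          = (if 1 \<in> V then U else {}) \<union> (if 0 \<in> V then topspace X - U else {})"
        using openin_subset[OF U(1)] by (auto simp: ch_def)
      then show ?thesis
        using U by auto
    qed
    then have "continuous_map X two (ch U)"
      by (auto simp: continuous_map_def two_def ch_def)
    then show ?thesis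
      by (simp add: cont_maps_def ch_def)
  qed
  have ch\<M>: "ch U \<in> cont_maps X two" if "U \<in> \<M>" for U
    using ch that \<M>(1) by (auto simp: \<C>_def)
  \<comment> \<open>Convergence to \<open>ch {}\<close> on the subbase: \<open>ch U\<close> can
    leave \<open>V\<close> on \<open>C\<close> only if \<open>U\<close> meets \<open>C\<close>, and
    each of the finitely many points of \<open>C\<close> lies in at most one member.\<close>
  have "finite {U \<in> \<M>. \<not> ch U ` C \<subseteq> V}"
    if C: "compactin X C" and V: "ch {} ` C \<subseteq> V" for C V
  proof -
    have CX: "C \<subseteq> topspace X"
      using C by (rule compactin_subset_topspace)
    have "\<exists>c \<in> C. c \<in> U" if "\<not> ch U ` C \<subseteq> V" for U
      using that V CX by (fastforce simp: ch_def image_subset_iff)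
    then have "{U \<in> \<M>. \<not> ch U ` C \<subseteq> V} \<subseteq> (\<Union>c\<in>C. {U \<in> \<M>. c \<in> U})"
      by blast
    moreover have "finite {U \<in> \<M>. c \<in> U}" for c
    proof (cases "\<exists>U\<in>\<M>. c \<in> U")
      case True
      then obtain U where "U \<in> \<M>" "c \<in> U" by blast
      then have "{U \<in> \<M>. c \<in> U} \<subseteq> {U}"
        using \<M>(2) by (auto simp: pairwise_def disjnt_def)
      then show ?thesis
        using finite_subset by blast
    next
      case False
      then have "{U \<in> \<M>. c \<in> U} = {}" by blast
      then show ?thesis by (simp only: finite.emptyI)
    qed
    ultimately show ?thesis
      using P_space_compactin_imp_finite[OF assms(2) t1 C] by (auto elim: finite_subset)
  qed
  then have cofin: "finite {U \<in> \<M>. ch U \<notin> W}" if "openin (Ck X two) W" "ch {} \<in> W" for W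
    using that ch\<M> by (intro finite_not_in_openin_Ck) auto
  define K where "K = insert (ch {}) (ch ` \<M>)"
  have "compactin (Ck X two) K"
    unfolding K_def using ch ch\<M> cofin
    by (intro compactin_insert_cofinite) (auto simp: topspace_Ck)
  then have ev: "continuous_map (prod_topology (subtopology (Ck X two) K) X) two (\<lambda>(f, x). f x)"
    using Ascoli by (auto simp: two_Ascoli_def evenly_continuous_def)
  \<comment> \<open>The preimage of 0 under evaluation. Even continuity makes it open, so it
    contains a box \<open>W' \<times> N\<close> around \<open>(ch {}, x)\<close>.\<close>
  let ?P = "{q \<in> topspace (prod_topology (subtopology (Ck X two) K) X). (\<lambda>(f, x). f x) q \<in> {0}}"
  have "openin (prod_topology (subtopology (Ck X two) K) X) ?P"
    by (rule openin_continuous_map_preimage[OF ev]) (simp add: two_def)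
  moreover have "(ch {}, x) \<in> ?P"
    using x ch[of "{}"] by (auto simp: K_def topspace_Ck) (simp add: ch_def)
  ultimately obtain W' N where "openin (subtopology (Ck X two) K) W'" "ch {} \<in> W'"
    and N: "openin X N" "x \<in> N" and sub: "W' \<times> N \<subseteq> ?P"
    unfolding openin_prod_topology_alt by meson
  then obtain W where W: "openin (Ck X two) W" "ch {} \<in> W" "W' = W \<inter> K"
    by (auto simp: openin_subtopology)
  \<comment> \<open>Evaluation vanishes on the box, so a member whose characteristic function lies
    in \<open>W\<close> cannot meet \<open>N\<close>.\<close>
  have zero: "disjnt N U" if "U \<in> \<M>" "ch U \<in> W" for U
  proof -
    have "ch U t = 0" if "t \<in> N" for t
    proof -
      have "(ch U, t) \<in> W' \<times> N"
        using that \<open>U \<in> \<M>\<close> \<open>ch U \<in> W\<close> W(3) by (simp add: K_def)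
      then have "(ch U, t) \<in> ?P"
        using sub by (rule rev_subsetD)
      then show ?thesis by simp
    qed
    then show ?thesis
      using openin_subset[OF N(1)] by (force simp: disjnt_def ch_def)
  qed
  \<comment> \<open>Only finitely many members are removed, all closed and missing \<open>x\<close>,
    so \<open>G\<close> is an open neighborhood of \<open>x\<close>. It meets no member at all,
    against \<open>meets\<close>.\<close>
  define G where "G = N - \<Union>{U \<in> \<M>. ch U \<notin> W}"
  have "openin X G"
    unfolding G_def using N cofin[OF W(1,2)] \<M>(1)
    by (intro openin_diff closedin_Union) (auto simp: \<C>_def)
  moreover have "x \<in> G"
    using N \<M>(1) by (auto simp: G_def \<C>_def)
  ultimately obtain U where "U \<in> \<M>" "\<not> disjnt G U"
    using meets by blast
  then show False
    using zero[of U] by (auto simp: G_def disjnt_def)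
qed

section \<open>Baire subspaces of the one-point Lindelofication\<close>

lemma Baire_space_if_at_most_one_nonisolated:
  assumes iso: "\<And>d. \<lbrakk>d \<in> topspace X; d \<noteq> p\<rbrakk> \<Longrightarrow> openin X {d}"
  shows "Baire_space X"
  unfolding Baire_space_def
proof (intro allI impI)
  fix \<U> assume \<U>: "countable \<U> \<and> (\<forall>U\<in>\<U>. openin X U \<and> X closure_of U = topspace X)"
  \<comment> \<open>A dense set meets the open singleton of every isolated point, hence contains
    that point.\<close>
  have isoU: "d \<in> U" if "openin X {d}" "U \<in> \<U>" for d U
  proof -
    have "d \<in> X closure_of U"
      using \<U> that openin_subset by fastforce
    then show ?thesis
      using that(1) by (auto simp: in_closure_of)
  qed
  have "\<exists>y. y \<in> topspace X \<inter> \<Inter>\<U> \<and> y \<in> T" if T: "openin X T" "x \<in> T" for x T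
  proof -
    \<comment> \<open>Every nonempty open set has an isolated point: if \<open>T\<close> is
      \<open>{p}\<close>, then \<open>p\<close> itself is isolated, and otherwise \<open>T\<close>
      has a point other than \<open>p\<close>.\<close>
    obtain d where "d \<in> T" "openin X {d}"
    proof (cases "T = {p}")
      case True
      then show thesis
        using T that by simp
    next
      case False
      then obtain d where "d \<in> T" "d \<noteq> p"
        using T by blast
      then show thesis
        using iso openin_subset[OF T(1)] that by blast
    qed
    then show ?thesis
      using isoU openin_subset[OF T(1)] by blast
  qed
  then show "X closure_of (topspace X \<inter> \<Inter>\<U>) = topspace X"
    by (auto simp: in_closure_of)
qed

lemma one_point_Lindelofication_hereditarily_Baire:
  assumes "one_point_Lindelofication X D p"
  shows "hereditarily Baire_space X"
  unfolding hereditarily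
proof
  fix S
  have "openin (subtopology X S) {d}" if "d \<in> topspace (subtopology X S)" "d \<noteq> p" for d
  proof -
    have "openin X {d}" "d \<in> S"
      using assms that by (auto simp: one_point_Lindelofication_def)
    then show ?thesis
      by (auto simp: openin_subtopology)
  qed
  then show "Baire_space (subtopology X S)"
    by (rule Baire_space_if_at_most_one_nonisolated)
qed

theorem proposition2p18:
  fixes X :: "'a topology"
  assumes "Tychonoff_space X"
    and "P_space X"
    and "X \<noteq> discrete_topology (topspace X)"
  shows "hereditarily sequentially_Ascoli X
    \<and> \<not> two_Ascoli X
    \<and> ((\<exists>D p. one_point_Lindelofication X D p) \<longrightarrow> hereditarily Baire_space X)"
proof (intro conjI impI)
  show "hereditarily sequentially_Ascoli X"
    unfolding hereditarily
    using assms(2) by (intro allI P_space_sequentially_Ascoli P_space_subtopology)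
  show "\<not> two_Ascoli X"
    using assms by (rule P_space_not_two_Ascoli)
  show "hereditarily Baire_space X" if "\<exists>D p. one_point_Lindelofication X D p"
    using that one_point_Lindelofication_hereditarily_Baire by metis
qed

end
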